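(* Let $M,T,J$ be natural numbers, put $P := MT$, and assume $P\geq J$. Let $G$ be the constraint graph of $\mathrm{OSSP}(M,T,J)$ and let $F\leq \mathrm{Sym}([M]\times[T]\times[J])$ be its group of feasibility-preserving permutations. Then $$F=\mathrm{Aut}(G)\cong\begin{cases}(S_J\times S_J)\rtimes S_2 & \text{if } P=J,\\ S_P\times S_J & \text{if } P>J,\end{cases}$$ where $S_n$ denotes the symmetric group on $n$ letters and $(S_J\times S_J)\rtimes S_2$ is the wreath product, i.e. the non-trivial element of $S_2$ acts by interchanging the two factors $S_J$.
   Context: Notation: $[n]=\{1,\ldots,n\}$. The open-shop scheduling problem $\mathrm{OSSP}(M,T,J)$ has $M$ machines, $T$ time slots per machine and $J$ jobs. Its constraint graph $G=(V,E)$ is the simple undirected graph with vertex set $V=[M]\times[T]\times[J]$ in which two distinct vertices $(m,t,j)$ and $(m',t',j')$ are adjacent if and only if ($m=m'$ and $t=t'$) or $j=j'$. A solution is a subset $W\subseteq V$ with $|W|=J$ that is an independent set of $G$. (Equivalently, $W=\{(m_j,t_j,j): j\in[J]\}$ with pairwise distinct positions $(m_j,t_j)\in[M]\times[T]$.) A permutation $\rho:V\to V$ is called feasibility-preserving if $\rho(W)$ is a solution whenever $W\subseteq V$ is a solution; $F$ denotes the set of all feasibility-preserving permutations, which is a subgroup of $\mathrm{Sym}(V)$. $\mathrm{Aut}(G)$ is the group of graph automorphisms of $G$.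
   Formalization: M, T, J are taken positive, and the isomorphism with the wreath product for P = J is claimed only for J ≠ 1: for M = T = J = 1 the graph is one vertex, so Aut(G) is trivial while (S_1×S_1)⋊S_2 has order 2; F = Aut(G) is still claimed there. *)

theory Defs
  imports "HOL-Algebra.Sym_Groups"
begin

section \<open>Symmetric groups and semidirect products\<close>

text \<open>The analogue of \<^const>\<open>sym_group\<close> for an arbitrary set.\<close>

definition perm_group :: "'a set \<Rightarrow> ('a \<Rightarrow> 'a) monoid" where
  "perm_group V = \<lparr>carrier = {p. p permutes V}, mult = (\<circ>), one = id\<rparr>"

lemma sym_group_eq_perm_group: "sym_group n = perm_group {1..n}"
  by (simp add: sym_group_def perm_group_def)

lemma group_perm_group: "group (perm_group V)"
proof (rule groupI)
  fix p assume "p \<in> carrier (perm_group V)"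
  then have "Hilbert_Choice.inv p permutes V" "Hilbert_Choice.inv p \<circ> p = id"
    by (auto simp: perm_group_def permutes_inv permutes_inv_o)
  then show "\<exists>q\<in>carrier (perm_group V). q \<otimes>\<^bsub>perm_group V\<^esub> p = \<one>\<^bsub>perm_group V\<^esub>"
    by (auto simp: perm_group_def)
qed (auto simp: perm_group_def permutes_compose permutes_id comp_assoc)

definition semidirect ::
  "('n, 'a) monoid_scheme \<Rightarrow> ('h, 'b) monoid_scheme \<Rightarrow> ('h \<Rightarrow> 'n \<Rightarrow> 'n) \<Rightarrow> ('n \<times> 'h) monoid"
where
  "semidirect N H \<phi> =
    \<lparr>carrier = carrier N \<times> carrier H,
     mult = (\<lambda>(n, h) (n', h'). (n \<otimes>\<^bsub>N\<^esub> \<phi> h n', h \<otimes>\<^bsub>H\<^esub> h')),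
     one = (\<one>\<^bsub>N\<^esub>, \<one>\<^bsub>H\<^esub>)\<rparr>"

lemma group_semidirect:
  fixes N (structure) and H (structure)
  assumes N: "group N" and H: "group H"
    and aut: "\<And>h. h \<in> carrier H \<Longrightarrow> \<phi> h \<in> iso N N"
    and one: "\<And>n. n \<in> carrier N \<Longrightarrow> \<phi> \<one>\<^bsub>H\<^esub> n = n"
    and act: "\<And>h h' n. \<lbrakk>h \<in> carrier H; h' \<in> carrier H; n \<in> carrier N\<rbrakk>
                \<Longrightarrow> \<phi> (h \<otimes>\<^bsub>H\<^esub> h') n = \<phi> h (\<phi> h' n)"
  shows "group (semidirect N H \<phi>)"
proof -
  interpret N: group N by (rule N)
  interpret H: group H by (rule H)
  have cl: "\<phi> h n \<in> carrier N" if "h \<in> carrier H" "n \<in> carrier N" for h n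
    using aut[OF that(1)] that(2) by (auto simp: iso_def hom_def)
  have mu: "\<phi> h (n \<otimes>\<^bsub>N\<^esub> n') = \<phi> h n \<otimes>\<^bsub>N\<^esub> \<phi> h n'"
    if "h \<in> carrier H" "n \<in> carrier N" "n' \<in> carrier N" for h n n'
    using aut[OF that(1)] that(2,3) by (auto simp: iso_def hom_def)
  show ?thesis
  proof (rule groupI)
    fix x assume "x \<in> carrier (semidirect N H \<phi>)"
    then obtain n h where x: "x = (n, h)" "n \<in> carrier N" "h \<in> carrier H"
      by (auto simp: semidirect_def)
    define y where "y = (\<phi> (inv\<^bsub>H\<^esub> h) (inv\<^bsub>N\<^esub> n), inv\<^bsub>H\<^esub> h)"
    have h: "inv\<^bsub>H\<^esub> h \<in> carrier H" using x by simp
    have "\<phi> (inv\<^bsub>H\<^esub> h) (inv\<^bsub>N\<^esub> n) \<otimes>\<^bsub>N\<^esub> \<phi> (inv\<^bsub>H\<^esub> h) n = \<phi> (inv\<^bsub>H\<^esub> h) \<one>\<^bsub>N\<^esub>"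
      using mu[OF h, of "inv\<^bsub>N\<^esub> n" n] x by simp
    also have "\<dots> = \<one>\<^bsub>N\<^esub>"
      using hom_one[OF _ N N, of "\<phi> (inv\<^bsub>H\<^esub> h)"] aut[OF h] by (auto simp: iso_def)
    finally have "y \<in> carrier (semidirect N H \<phi>)"
        "y \<otimes>\<^bsub>semidirect N H \<phi>\<^esub> x = \<one>\<^bsub>semidirect N H \<phi>\<^esub>"
      using x h cl by (auto simp: y_def semidirect_def)
    then show "\<exists>y\<in>carrier (semidirect N H \<phi>). y \<otimes>\<^bsub>semidirect N H \<phi>\<^esub> x = \<one>\<^bsub>semidirect N H \<phi>\<^esub>"
      by blast
  qed (auto simp: semidirect_def cl mu act one N.m_assoc H.m_assoc)
qed

definition interchange :: "(nat \<Rightarrow> nat) \<Rightarrow> 'a \<times> 'a \<Rightarrow> 'a \<times> 'a" where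
  "interchange s = (if s = id then id else prod.swap)"

definition wreath_S2 :: "nat \<Rightarrow> (((nat \<Rightarrow> nat) \<times> (nat \<Rightarrow> nat)) \<times> (nat \<Rightarrow> nat)) monoid" where
  "wreath_S2 n = semidirect (sym_group n \<times>\<times> sym_group n) (sym_group 2) interchange"

lemma permutes_1_2: "p permutes {1..2::nat} \<Longrightarrow> p = id \<or> p = transpose 1 2"
proof -
  have "{1..2::nat} = {1, 2}" by auto
  then show "p permutes {1..2::nat} \<Longrightarrow> p = id \<or> p = transpose 1 2"
    by (metis permutes_doubleton_iff)
qed

lemma interchange_iso:
  fixes G :: "('a, 'b) monoid_scheme"
  shows "interchange s \<in> iso (G \<times>\<times> G) (G \<times>\<times> G)"
proof -
  have "id \<in> iso (G \<times>\<times> G) (G \<times>\<times> G)"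
    by (rule iso_set_refl[unfolded id_def[symmetric]])
  moreover have "prod.swap \<in> iso (G \<times>\<times> G) (G \<times>\<times> G)"
  proof -
    have "prod.swap = (\<lambda>(x :: 'a, y :: 'a). (y, x))" by auto
    then show ?thesis using DirProd_commute_iso_set[of G G] by (simp only:)
  qed
  ultimately show ?thesis by (simp add: interchange_def)
qed

lemma group_wreath_S2: "group (wreath_S2 n)"
  unfolding wreath_S2_def
proof (rule group_semidirect)
  show "group (sym_group n \<times>\<times> sym_group n)" "group (sym_group 2)"
    by (simp_all add: DirProd_group sym_group_is_group)
next
  fix h h' :: "nat \<Rightarrow> nat" and x :: "(nat \<Rightarrow> nat) \<times> (nat \<Rightarrow> nat)"
  assume "h \<in> carrier (sym_group 2)" "h' \<in> carrier (sym_group 2)"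
  then have "h = id \<or> h = transpose 1 2" "h' = id \<or> h' = transpose 1 2"
    by (simp_all only: sym_group_carrier permutes_1_2)
  then show "interchange (h \<otimes>\<^bsub>sym_group 2\<^esub> h') x = interchange h (interchange h' x)"
    by (elim disjE) (simp_all add: interchange_def sym_group_mult)
next
  show "interchange h \<in> iso (sym_group n \<times>\<times> sym_group n) (sym_group n \<times>\<times> sym_group n)" for h
    by (rule interchange_iso)
  show "interchange \<one>\<^bsub>sym_group 2\<^esub> x = x" for x :: "(nat \<Rightarrow> nat) \<times> (nat \<Rightarrow> nat)"
    by (simp add: interchange_def sym_group_one)
qed

section \<open>Graphs, given by a vertex set and a set of two-element edges\<close>

definition graph_aut :: "'v set \<Rightarrow> 'v set set \<Rightarrow> ('v \<Rightarrow> 'v) set" where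
  "graph_aut V E = {\<rho>. \<rho> permutes V \<and> (\<forall>u\<in>V. \<forall>v\<in>V. {u, v} \<in> E \<longleftrightarrow> {\<rho> u, \<rho> v} \<in> E)}"

definition independent :: "'v set \<Rightarrow> 'v set set \<Rightarrow> 'v set \<Rightarrow> bool" where
  "independent V E W \<longleftrightarrow> W \<subseteq> V \<and> (\<forall>u\<in>W. \<forall>v\<in>W. {u, v} \<notin> E)"

section \<open>Open-shop scheduling\<close>

definition ossp_verts :: "nat \<Rightarrow> nat \<Rightarrow> nat \<Rightarrow> (nat \<times> nat \<times> nat) set" where
  "ossp_verts M T J = {1..M} \<times> {1..T} \<times> {1..J}"

definition ossp_edges :: "nat \<Rightarrow> nat \<Rightarrow> nat \<Rightarrow> (nat \<times> nat \<times> nat) set set" where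
  "ossp_edges M T J =
    {{(m, t, j), (m', t', j')} | m t j m' t' j'.
      (m, t, j) \<in> ossp_verts M T J \<and> (m', t', j') \<in> ossp_verts M T J \<and>
      (m, t, j) \<noteq> (m', t', j') \<and> (m = m' \<and> t = t' \<or> j = j')}"

definition ossp_solution :: "nat \<Rightarrow> nat \<Rightarrow> nat \<Rightarrow> (nat \<times> nat \<times> nat) set \<Rightarrow> bool" where
  "ossp_solution M T J W \<longleftrightarrow>
    W \<subseteq> ossp_verts M T J \<and> card W = J \<and> independent (ossp_verts M T J) (ossp_edges M T J) W"

definition feas_perms ::
  "nat \<Rightarrow> nat \<Rightarrow> nat \<Rightarrow> (nat \<times> nat \<times> nat \<Rightarrow> nat \<times> nat \<times> nat) set" where
  "feas_perms M T J =
    {\<rho>. \<rho> permutes ossp_verts M T J \<and>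
        (\<forall>W. ossp_solution M T J W \<longrightarrow> ossp_solution M T J (\<rho> ` W))}"

lemma subgroup_graph_aut: "subgroup (graph_aut V E) (perm_group V)"
proof -
  interpret group "perm_group V" by (rule group_perm_group)
  show ?thesis
  proof (rule subgroupI)
    have "id \<in> graph_aut V E" by (simp add: graph_aut_def permutes_id)
    then show "graph_aut V E \<noteq> {}" by blast
  next
    fix p assume p: "p \<in> graph_aut V E"
    then have pV: "p permutes V" by (simp add: graph_aut_def)
    have iV: "Hilbert_Choice.inv p permutes V" using pV by (rule permutes_inv)
    have "inv\<^bsub>perm_group V\<^esub> p = Hilbert_Choice.inv p"
      by (rule inv_equality) (use pV iV in \<open>auto simp: perm_group_def permutes_inv_o\<close>)
    moreover have "Hilbert_Choice.inv p \<in> graph_aut V E"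
      unfolding graph_aut_def
    proof (intro CollectI conjI ballI iV)
      fix u v assume "u \<in> V" "v \<in> V"
      then have "Hilbert_Choice.inv p u \<in> V" "Hilbert_Choice.inv p v \<in> V"
        using permutes_in_image[OF iV] by auto
      then show "{u, v} \<in> E \<longleftrightarrow> {Hilbert_Choice.inv p u, Hilbert_Choice.inv p v} \<in> E"
        using p by (simp add: graph_aut_def permutes_inverses(1)[OF pV])
    qed
    ultimately show "inv\<^bsub>perm_group V\<^esub> p \<in> graph_aut V E" by simp
  next
    fix p q assume pq: "p \<in> graph_aut V E" "q \<in> graph_aut V E"
    then have pV: "p permutes V" and qV: "q permutes V" by (simp_all add: graph_aut_def)
    have "{u, v} \<in> E \<longleftrightarrow> {p (q u), p (q v)} \<in> E" if "u \<in> V" "v \<in> V" for u v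
    proof -
      have "q u \<in> V" "q v \<in> V" using that by (simp_all only: permutes_in_image[OF qV])
      then show ?thesis using pq that by (simp add: graph_aut_def)
    qed
    then show "p \<otimes>\<^bsub>perm_group V\<^esub> q \<in> graph_aut V E"
      by (simp add: graph_aut_def perm_group_def permutes_compose[OF qV pV])
  qed (auto simp: graph_aut_def perm_group_def)
qed

lemma subgroup_feas_perms: "subgroup (feas_perms M T J) (perm_group (ossp_verts M T J))"
proof -
  let ?V = "ossp_verts M T J"
  interpret group "perm_group ?V" by (rule group_perm_group)
  have fin: "finite {W. ossp_solution M T J W}"
    by (rule finite_subset[of _ "Pow ?V"]) (auto simp: ossp_solution_def ossp_verts_def)
  show ?thesis
  proof (rule subgroupI)
    have "id \<in> feas_perms M T J" by (simp add: feas_perms_def permutes_id)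
    then show "feas_perms M T J \<noteq> {}" by blast
  next
    fix p assume p: "p \<in> feas_perms M T J"
    then have pV: "p permutes ?V" by (simp add: feas_perms_def)
    have iV: "Hilbert_Choice.inv p permutes ?V" using pV by (rule permutes_inv)
    have bp: "bij p" using pV by (rule permutes_bij)
    have inv: "inv\<^bsub>perm_group ?V\<^esub> p = Hilbert_Choice.inv p"
      by (rule inv_equality) (use pV iV in \<open>auto simp: perm_group_def permutes_inv_o\<close>)
    have surj: "(`) p ` {W. ossp_solution M T J W} = {W. ossp_solution M T J W}"
    proof (rule endo_inj_surj[OF fin])
      show "(`) p ` {W. ossp_solution M T J W} \<subseteq> {W. ossp_solution M T J W}"
        using p by (auto simp: feas_perms_def)
      show "inj_on ((`) p) {W. ossp_solution M T J W}"
        using bp by (auto simp: inj_on_def bij_def inj_image_eq_iff)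
    qed
    have "ossp_solution M T J (Hilbert_Choice.inv p ` W)" if "ossp_solution M T J W" for W
    proof -
      have "W \<in> (`) p ` {W. ossp_solution M T J W}"
        using that unfolding surj by simp
      then obtain W' where "ossp_solution M T J W'" "W = p ` W'"
        by (elim imageE CollectE)
      then show ?thesis using bij_is_inj[OF bp] by (simp only: image_inv_f_f)
    qed
    then show "inv\<^bsub>perm_group ?V\<^esub> p \<in> feas_perms M T J"
      using iV by (simp add: inv feas_perms_def)
  next
    fix p q assume pq: "p \<in> feas_perms M T J" "q \<in> feas_perms M T J"
    then have "ossp_solution M T J (p ` q ` W)" if "ossp_solution M T J W" for W
      using that by (simp add: feas_perms_def)
    then show "p \<otimes>\<^bsub>perm_group ?V\<^esub> q \<in> feas_perms M T J"
      using pq by (simp add: feas_perms_def perm_group_def permutes_compose image_comp)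
  qed (auto simp: feas_perms_def perm_group_def)
qed

text \<open>
  For \<open>M = T = J = 1\<close> the constraint graph is a single vertex, with trivial automorphism group,
  whereas the wreath product has order 2. This instance must be excluded from the
  isomorphism for \<open>M * T = J\<close>.
\<close>

lemma ossp_1_1_1_not_iso_wreath:
  "\<not> (perm_group (ossp_verts 1 1 1))\<lparr>carrier := graph_aut (ossp_verts 1 1 1) (ossp_edges 1 1 1)\<rparr>
      \<cong> wreath_S2 1"
proof
  assume "(perm_group (ossp_verts 1 1 1))
    \<lparr>carrier := graph_aut (ossp_verts 1 1 1) (ossp_edges 1 1 1)\<rparr> \<cong> wreath_S2 1"
  from iso_same_card[OF this]
  have eq: "card (graph_aut (ossp_verts 1 1 1) (ossp_edges 1 1 1)) = card (carrier (wreath_S2 1))"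
    by simp
  have "ossp_verts 1 1 1 = {(1, 1, 1)}" by (simp add: ossp_verts_def)
  then have "graph_aut (ossp_verts 1 1 1) (ossp_edges 1 1 1) \<subseteq> {id}"
    by (simp add: graph_aut_def subset_iff permutes_sing)
  from card_mono[OF _ this]
  have le: "card (graph_aut (ossp_verts 1 1 1) (ossp_edges 1 1 1)) \<le> 1" by simp
  have S: "card (carrier (sym_group n)) = fact n" for n
    unfolding sym_group_def by (simp add: card_permutations)
  have "carrier (wreath_S2 1) =
      (carrier (sym_group 1) \<times> carrier (sym_group 1)) \<times> carrier (sym_group 2)"
    by (simp only: wreath_S2_def semidirect_def DirProd_def partial_object.simps)
  then have "card (carrier (wreath_S2 1)) = 2"
    by (simp only: card_cartesian_product S fact_1 fact_2)
  with eq le show False by simp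
qed

end

theory Submission
  imports Defs
begin

text \<open>
  Two distinct non-adjacent vertices always lie in a common solution because \<open>J \<le> M * T\<close>, and two
  adjacent ones never do, so feasibility-preserving permutations are exactly the automorphisms.
  Numbering the positions turns the constraint graph into the rook graph on
  \<open>{1..M * T} \<times> {1..J}\<close>. A clique of a rook graph lies in a single line, so by its size the image of a
  column of length \<open>M * T\<close> is again a column, or possibly a row if \<open>M * T = J\<close>. Columns are pairwise
  disjoint while rows meet columns, hence columns are sent all to columns or all to rows. Up to
  transposition an automorphism therefore preserves columns, and then adjacency across columns
  forces it to be a product of two permutations.
\<close>

section \<open>Automorphisms of rook graphs\<close>

text \<open>This is the reflexive closure of rook adjacency, which bijections preserve just as well.\<close>

definition collinear :: "'a \<times> 'b \<Rightarrow> 'a \<times> 'b \<Rightarrow> bool" where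
  "collinear u v \<longleftrightarrow> fst u = fst v \<or> snd u = snd v"

text \<open>Otherwise some \<open>v\<close> differs from a fixed \<open>u\<close> in the first
  coordinate and some \<open>w\<close> differs from it in the second. Both are collinear with
  \<open>u\<close>, so the three form a corner whose ends \<open>v\<close> and \<open>w\<close>
  share no coordinate.\<close>

lemma collinear_clique_in_line:
  assumes "\<And>u v. u \<in> S \<Longrightarrow> v \<in> S \<Longrightarrow> collinear u v"
  shows "(\<exists>a. \<forall>u\<in>S. fst u = a) \<or> (\<exists>b. \<forall>u\<in>S. snd u = b)"
proof (rule ccontr)
  assume contra: "\<not> ?thesis"
  then obtain u where u: "u \<in> S" by blast
  from contra obtain v where v: "v \<in> S" "fst v \<noteq> fst u" by blast
  from contra obtain w where w: "w \<in> S" "snd w \<noteq> snd u" by blast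
  have "snd v = snd u" "fst w = fst u"
    using assms[OF v(1) u] assms[OF w(1) u] v w by (auto simp: collinear_def)
  then show False
    using assms[OF v(1) w(1)] v w by (auto simp: collinear_def)
qed

text \<open>A column is a set \<open>A \<times> {b}\<close>. Once columns go into columns,
  collinearity of points in different columns forces the first coordinate of the image to depend on
  \<open>a\<close> alone. Separate target sets \<open>C\<close> and \<open>D\<close> let the result
  also cover a map followed by a swap of coordinates.\<close>

lemma column_preserving_is_product:
  fixes f :: "'a \<times> 'b \<Rightarrow> 'c \<times> 'd"
  assumes f: "bij_betw f (A \<times> B) (C \<times> D)"
    and col: "\<And>u v. u \<in> A \<times> B \<Longrightarrow> v \<in> A \<times> B \<Longrightarrow> collinear (f u) (f v) \<longleftrightarrow> collinear u v"
    and snd: "\<And>a a' b. a \<in> A \<Longrightarrow> a' \<in> A \<Longrightarrow> b \<in> B \<Longrightarrow> snd (f (a, b)) = snd (f (a', b))"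
    and A: "a0 \<in> A" "a1 \<in> A" "a0 \<noteq> a1" and B: "b0 \<in> B"
  shows "\<exists>\<tau> \<sigma>. bij_betw \<tau> A C \<and> bij_betw \<sigma> B D \<and> (\<forall>a\<in>A. \<forall>b\<in>B. f (a, b) = (\<tau> a, \<sigma> b))"
proof -
  define \<tau> where "\<tau> a = fst (f (a, b0))" for a
  define \<sigma> where "\<sigma> b = snd (f (a0, b))" for b
  have inj: "f u = f v \<Longrightarrow> u = v" if "u \<in> A \<times> B" "v \<in> A \<times> B" for u v
    using f that by (meson bij_betw_inv_into_left inj_onD bij_betw_def)
  have im: "f (a, b) \<in> C \<times> D" if "a \<in> A" "b \<in> B" for a b
    using bij_betwE[OF f] that by blast
  have \<sigma>: "snd (f (a, b)) = \<sigma> b" if "a \<in> A" "b \<in> B" for a b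
    unfolding \<sigma>_def using snd that A by blast
  have \<sigma>_inj: "b = b'" if "b \<in> B" "b' \<in> B" "\<sigma> b = \<sigma> b'" for b b'
  proof -
    \<comment> \<open>If two columns had the same target, these points would have collinear images;
      as \<open>a0 \<noteq> a1\<close>, they are themselves collinear only for
      \<open>b = b'\<close>.\<close>
    have "collinear (f (a0, b)) (f (a1, b'))"
      using \<sigma> that A by (simp add: collinear_def)
    then show ?thesis using col[of "(a0, b)" "(a1, b')"] that A by (simp add: collinear_def)
  qed
  have \<tau>: "fst (f (a, b)) = \<tau> a" if "a \<in> A" "b \<in> B" for a b
  proof (cases "b = b0")
    case False
    \<comment> \<open>The two points share a row, but their images lie in different columns, so the
      images must share the first coordinate.\<close>
    have "collinear (f (a, b)) (f (a, b0))"
      using col[of "(a, b)" "(a, b0)"] that B by (simp add: collinear_def)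
    moreover have "snd (f (a, b)) \<noteq> snd (f (a, b0))"
      using \<sigma> \<sigma>_inj[of b b0] that B False by auto
    ultimately show ?thesis by (simp add: collinear_def \<tau>_def)
  qed (simp add: \<tau>_def)
  have prod: "f (a, b) = (\<tau> a, \<sigma> b)" if "a \<in> A" "b \<in> B" for a b
    using \<sigma> \<tau> that by (simp add: prod_eq_iff)
  have surj: "\<exists>a\<in>A. \<exists>b\<in>B. c = \<tau> a \<and> d = \<sigma> b" if "c \<in> C" "d \<in> D" for c d
  proof -
    have "(c, d) \<in> f ` (A \<times> B)" using f that by (simp add: bij_betw_def)
    then show ?thesis using prod by auto
  qed
  \<comment> \<open>These provide the other coordinate when \<open>surj\<close> is used for one
    factor only.\<close>
  have CD: "\<tau> a0 \<in> C" "\<sigma> b0 \<in> D"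
    using im[OF A(1) B] prod[OF A(1) B] by auto
  have "bij_betw \<tau> A C"
  proof (rule bij_betwI')
    fix a a' assume "a \<in> A" "a' \<in> A"
    then show "\<tau> a = \<tau> a' \<longleftrightarrow> a = a'"
      using inj[of "(a, b0)" "(a', b0)"] prod B by auto
  next
    fix a assume "a \<in> A"
    then show "\<tau> a \<in> C" using im[of a b0] prod[of a b0] B by auto
  next
    fix c assume "c \<in> C"
    then show "\<exists>a\<in>A. c = \<tau> a" using surj CD by blast
  qed
  moreover have "bij_betw \<sigma> B D"
  proof (rule bij_betwI')
    fix b b' assume "b \<in> B" "b' \<in> B"
    then show "\<sigma> b = \<sigma> b' \<longleftrightarrow> b = b'" using \<sigma>_inj by blast
  next
    fix b assume "b \<in> B"
    then show "\<sigma> b \<in> D" using im[of a0 b] prod[of a0 b] A by auto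
  next
    fix d assume "d \<in> D"
    then show "\<exists>b\<in>B. d = \<sigma> b" using surj CD by blast
  qed
  ultimately show ?thesis using prod by blast
qed

text \<open>Columns have \<open>card A\<close> points and rows \<open>card B \<le> card A\<close>,
  so a row can contain the image of a column only by being filled by it. One column sent to a row
  then drags all others along.\<close>

lemma rook_automorphism_cases:
  fixes f :: "'a \<times> 'b \<Rightarrow> 'a \<times> 'b"
  assumes f: "bij_betw f (A \<times> B) (A \<times> B)"
    and col: "\<And>u v. u \<in> A \<times> B \<Longrightarrow> v \<in> A \<times> B \<Longrightarrow> collinear (f u) (f v) \<longleftrightarrow> collinear u v"
    and fin: "finite A" "finite B" and card: "card B \<le> card A"
    and A: "a0 \<in> A" "a1 \<in> A" "a0 \<noteq> a1" and B: "b0 \<in> B"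
  obtains (straight) \<tau> \<sigma> where "bij_betw \<tau> A A" "bij_betw \<sigma> B B"
      "\<And>a b. a \<in> A \<Longrightarrow> b \<in> B \<Longrightarrow> f (a, b) = (\<tau> a, \<sigma> b)"
  | (transposed) \<tau> \<sigma> where "card A = card B" "bij_betw \<tau> B A" "bij_betw \<sigma> A B"
      "\<And>a b. a \<in> A \<Longrightarrow> b \<in> B \<Longrightarrow> f (a, b) = (\<tau> b, \<sigma> a)"
proof -
  have inj: "inj_on f (A \<times> B)" using f by (simp add: bij_betw_def)
  have sub: "f ` (A \<times> {b}) \<subseteq> A \<times> B" if "b \<in> B" for b
    using f that by (auto simp: bij_betw_def)
  have card_column: "card (f ` (A \<times> {b})) = card A" if "b \<in> B" for b
  proof -
    have "inj_on f (A \<times> {b})" by (rule inj_on_subset[OF inj]) (use that in auto)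
    then show ?thesis by (simp add: card_image card_cartesian_product)
  qed
  have line: "(\<exists>a. \<forall>u\<in>f ` (A \<times> {b}). fst u = a) \<or> (\<exists>y. \<forall>u\<in>f ` (A \<times> {b}). snd u = y)"
    if "b \<in> B" for b
  proof (rule collinear_clique_in_line)
    fix u v assume "u \<in> f ` (A \<times> {b})" "v \<in> f ` (A \<times> {b})"
    then obtain a a' where "a \<in> A" "a' \<in> A" "u = f (a, b)" "v = f (a', b)" by auto
    then show "collinear u v" using col[of "(a, b)" "(a', b)"] that by (simp add: collinear_def)
  qed
  show thesis
  proof (cases "\<forall>b\<in>B. \<exists>y. \<forall>u\<in>f ` (A \<times> {b}). snd u = y")
    case True
    have const: "snd (f (a, b)) = snd (f (a', b))" if "a \<in> A" "a' \<in> A" "b \<in> B" for a a' b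
      using bspec[OF True that(3)] that by auto
    from column_preserving_is_product[OF f col const A B] show thesis
      using straight by blast
  next
    case False
    then obtain b where b: "b \<in> B" "\<nexists>y. \<forall>u\<in>f ` (A \<times> {b}). snd u = y" by blast
    then obtain x where x: "\<forall>u\<in>f ` (A \<times> {b}). fst u = x" using line by blast
    have xA: "x \<in> A" using x sub[OF b(1)] A(1) by force
    have row: "f ` (A \<times> {b}) \<subseteq> {x} \<times> B"
    proof
      fix u assume u: "u \<in> f ` (A \<times> {b})"
      then have "u \<in> A \<times> B" "fst u = x" using sub[OF b(1)] x by blast+
      then show "u \<in> {x} \<times> B" by (auto simp: mem_Times_iff)
    qed
    \<comment> \<open>The column keeps its \<open>card A\<close> points under the injective
      \<open>f\<close> and now sits in a row of \<open>card B\<close> points; equality of the sizes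
      makes the image the whole row.\<close>
    have "card A \<le> card ({x} \<times> B)"
      using card_mono[OF _ row] card_column[OF b(1)] fin by simp
    then have cardAB: "card A = card B" using card by (simp add: card_cartesian_product)
    have row_eq: "f ` (A \<times> {b}) = {x} \<times> B"
      by (rule card_subset_eq) (use fin row card_column[OF b(1)] cardAB in
          \<open>auto simp: card_cartesian_product\<close>)
    \<comment> \<open>If another column were sent onto the full column \<open>y\<close>, its image
      would meet the full row \<open>x\<close> in \<open>(x, y)\<close>, contradicting injectivity
      since distinct columns are disjoint.\<close>
    have fst_const: "\<exists>a. \<forall>u\<in>f ` (A \<times> {b'}). fst u = a" if b': "b' \<in> B" for b'
    proof (rule ccontr)
      assume contra: "\<nexists>a. \<forall>u\<in>f ` (A \<times> {b'}). fst u = a"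
      then have "b' \<noteq> b" using x by blast
      obtain y where y: "\<forall>u\<in>f ` (A \<times> {b'}). snd u = y" using line[OF b'] contra by blast
      have yB: "y \<in> B" using y sub[OF b'] A(1) by force
      have sub': "f ` (A \<times> {b'}) \<subseteq> A \<times> {y}"
      proof
        fix u assume u: "u \<in> f ` (A \<times> {b'})"
        then have "u \<in> A \<times> B" "snd u = y" using sub[OF b'] y by blast+
        then show "u \<in> A \<times> {y}" by (auto simp: mem_Times_iff)
      qed
      have "f ` (A \<times> {b'}) = A \<times> {y}"
       by (rule card_subset_eq) (use fin sub' card_column[OF b'] in
            \<open>auto simp: card_cartesian_product\<close>)
      then have "(x, y) \<in> f ` (A \<times> {b'})" "(x, y) \<in> f ` (A \<times> {b})"
        using xA yB row_eq by auto
      then obtain a a' where "a \<in> A" "a' \<in> A" "f (a, b') = f (a', b)" by auto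
      then show False using inj_onD[OF inj, of "(a, b')" "(a', b)"] b(1) b' \<open>b' \<noteq> b\<close> by auto
    qed
    \<comment> \<open>Now all columns go to rows, so exchanging the coordinates of the images gives
      a map to which the column-preserving case applies.\<close>
    let ?g = "prod.swap \<circ> f"
    have "bij_betw prod.swap (A \<times> B) (B \<times> A)"
      by (auto simp: bij_betw_def product_swap)
    then have g: "bij_betw ?g (A \<times> B) (B \<times> A)" using f by (rule bij_betw_trans[rotated])
    have colg: "collinear (?g u) (?g v) \<longleftrightarrow> collinear u v" if "u \<in> A \<times> B" "v \<in> A \<times> B" for u v
      using col[OF that] by (auto simp: collinear_def)
    have const: "snd (?g (a, b)) = snd (?g (a', b))" if "a \<in> A" "a' \<in> A" "b \<in> B" for a a' b
      using fst_const[OF that(3)] that by auto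
    obtain \<sigma> \<tau> where st: "bij_betw \<sigma> A B" "bij_betw \<tau> B A"
        "\<forall>a\<in>A. \<forall>b\<in>B. ?g (a, b) = (\<sigma> a, \<tau> b)"
      using column_preserving_is_product[OF g colg const A B] by blast
    have "f (a, b) = (\<tau> b, \<sigma> a)" if "a \<in> A" "b \<in> B" for a b
      using st(3) that by (auto simp: prod_eq_iff)
    then show thesis using transposed cardAB st(1,2) by blast
  qed
qed

section \<open>Permutation groups from faithful actions\<close>

lemma bij_betw_extends_to_permutation:
  assumes "bij_betw f A A"
  obtains p where "p permutes A" "\<And>x. x \<in> A \<Longrightarrow> p x = f x"
proof
  let ?p = "\<lambda>x. if x \<in> A then f x else x"
  have "bij_betw ?p A A" using assms by (simp cong: bij_betw_cong)
  then show "?p permutes A" by (rule bij_imp_permutes) simp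
qed simp

text \<open>Conjugating the action of \<open>K\<close> on \<open>W\<close> by \<open>h\<close> turns
  it into a homomorphism to the permutations of \<open>V\<close>. Faithfulness makes it injective,
  and \<open>image\<close> identifies its range with \<open>A\<close>.\<close>

lemma perm_group_iso_of_faithful_action:
  fixes K (structure)
  assumes K: "group K"
    and h: "bij_betw h V W"
    and act_bij: "\<And>k. k \<in> carrier K \<Longrightarrow> bij_betw (act k) W W"
    and act_mult: "\<And>k k' w. k \<in> carrier K \<Longrightarrow> k' \<in> carrier K \<Longrightarrow> w \<in> W
        \<Longrightarrow> act (k \<otimes> k') w = act k (act k' w)"
    and faithful: "\<And>k k'. k \<in> carrier K \<Longrightarrow> k' \<in> carrier K
        \<Longrightarrow> (\<And>w. w \<in> W \<Longrightarrow> act k w = act k' w) \<Longrightarrow> k = k'"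
    and image: "\<And>\<rho>. \<rho> \<in> A \<longleftrightarrow> \<rho> permutes V \<and> (\<exists>k\<in>carrier K. \<forall>v\<in>V. h (\<rho> v) = act k (h v))"
  shows "(perm_group V)\<lparr>carrier := A\<rparr> \<cong> K"
proof -
  \<comment> \<open>The default \<open>v\<close> outside \<open>V\<close> is what
    \<open>permutes\<close> demands.\<close>
  define \<Phi> where "\<Phi> k v = (if v \<in> V then inv_into V h (act k (h v)) else v)" for k v
  have hW: "h v \<in> W" if "v \<in> V" for v using h that by (rule bij_betw_apply)
  have hinv: "inv_into V h w \<in> V" "h (inv_into V h w) = w" if "w \<in> W" for w
    using h that by (metis bij_betw_apply bij_betw_inv_into, metis bij_betw_inv_into_right)
  have actW: "act k w \<in> W" if "k \<in> carrier K" "w \<in> W" for k w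
    using act_bij[OF that(1)] that(2) by (rule bij_betw_apply)
  have h\<Phi>: "h (\<Phi> k v) = act k (h v)" if "k \<in> carrier K" "v \<in> V" for k v
    using that hW actW hinv by (simp add: \<Phi>_def)
  have \<Phi>_perm: "\<Phi> k permutes V" if k: "k \<in> carrier K" for k
  proof (rule bij_imp_permutes)
    have "bij_betw (inv_into V h \<circ> (act k \<circ> h)) V V"
      by (intro bij_betw_trans[OF bij_betw_trans[OF h act_bij[OF k]]] bij_betw_inv_into[OF h])
    then show "bij_betw (\<Phi> k) V V" by (simp add: \<Phi>_def comp_def cong: bij_betw_cong)
  qed (simp add: \<Phi>_def)
  have eqI: "\<rho> = \<rho>'" if "\<rho> permutes V" "\<rho>' permutes V" "\<And>v. v \<in> V \<Longrightarrow> h (\<rho> v) = h (\<rho>' v)" for \<rho> \<rho>'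
  proof
    fix v
    show "\<rho> v = \<rho>' v"
    proof (cases "v \<in> V")
      case True
      then have "\<rho> v \<in> V" "\<rho>' v \<in> V" using that(1,2) by (simp_all add: permutes_in_image)
      then show ?thesis using that(3)[OF True] h by (meson bij_betw_def inj_onD)
    qed (use that in \<open>simp add: permutes_not_in\<close>)
  qed
  have "\<Phi> \<in> iso K ((perm_group V)\<lparr>carrier := A\<rparr>)"
  proof (rule isoI)
    show "\<Phi> \<in> hom K ((perm_group V)\<lparr>carrier := A\<rparr>)"
    proof (rule homI)
      fix k assume "k \<in> carrier K"
      then show "\<Phi> k \<in> carrier ((perm_group V)\<lparr>carrier := A\<rparr>)"
        using image \<Phi>_perm h\<Phi> by auto
    next
      fix k k' assume k: "k \<in> carrier K" "k' \<in> carrier K"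
      then have kk: "k \<otimes> k' \<in> carrier K" using K by (simp add: group.is_monoid monoid.m_closed)
      have "\<Phi> (k \<otimes> k') = \<Phi> k \<circ> \<Phi> k'"
      proof (rule eqI)
        fix v assume v: "v \<in> V"
        have "\<Phi> k' v \<in> V" using \<Phi>_perm[OF k(2)] v by (simp add: permutes_in_image)
        then show "h (\<Phi> (k \<otimes> k') v) = h ((\<Phi> k \<circ> \<Phi> k') v)"
          using v k kk hW by (simp add: h\<Phi> act_mult)
      qed (use k kk \<Phi>_perm permutes_compose in blast)+
      then show "\<Phi> (k \<otimes> k') = \<Phi> k \<otimes>\<^bsub>(perm_group V)\<lparr>carrier := A\<rparr>\<^esub> \<Phi> k'"
       by (simp add: perm_group_def)
    qed
    have "inj_on \<Phi> (carrier K)"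
    proof (rule inj_onI)
      fix k k' assume k: "k \<in> carrier K" "k' \<in> carrier K" "\<Phi> k = \<Phi> k'"
      show "k = k'"
      proof (rule faithful[OF k(1,2)])
        fix w assume "w \<in> W"
        then show "act k w = act k' w"
          using h\<Phi>[OF k(1), of "inv_into V h w"] h\<Phi>[OF k(2), of "inv_into V h w"] hinv k(3) by simp
      qed
    qed
    moreover have "\<rho> \<in> \<Phi> ` carrier K" if mem: "\<rho> \<in> A" for \<rho>
    proof -
      obtain k where k: "\<rho> permutes V" "k \<in> carrier K" "\<forall>v\<in>V. h (\<rho> v) = act k (h v)"
        using iffD1[OF image mem] by blast
      have "\<rho> = \<Phi> k" by (rule eqI[OF k(1) \<Phi>_perm[OF k(2)]]) (simp add: h\<Phi> k(2,3))
      then show ?thesis using k(2) by blast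
    qed
    moreover have "\<Phi> ` carrier K \<subseteq> A"
      using image[THEN iffD2] \<Phi>_perm h\<Phi> by blast
    ultimately show "bij_betw \<Phi> (carrier K) (carrier ((perm_group V)\<lparr>carrier := A\<rparr>))"
      by (auto simp: bij_betw_def)
  qed
  \<comment> \<open>The isomorphism was built starting from \<open>K\<close>, which is known to be a
    group, and is now reversed.\<close>
  then show ?thesis using group.iso_sym[OF K] by (auto simp: is_iso_def)
qed

lemma permutes_eqI:
  assumes "p permutes A" "q permutes A" "\<And>x. x \<in> A \<Longrightarrow> p x = q x"
  shows "p = q"
proof
  fix x
  show "p x = q x"
    using assms by (cases "x \<in> A") (simp_all add: permutes_not_in)
qed

lemma bij_betw_conjugate:
  assumes "bij_betw h V W" "\<rho> permutes V"
  shows "bij_betw (h \<circ> \<rho> \<circ> inv_into V h) W W"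
  using bij_betw_trans[OF bij_betw_inv_into[OF assms(1)]
      bij_betw_trans[OF permutes_imp_bij[OF assms(2)] assms(1)]] .

lemma bij_betw_map_prod:
  assumes "bij_betw f A C" "bij_betw g B D"
  shows "bij_betw (map_prod f g) (A \<times> B) (C \<times> D)"
  using assms by (auto simp: bij_betw_def map_prod_inj_on map_prod_surj_on)

section \<open>The constraint graph\<close>

lemma ossp_edge_iff:
  assumes "(m, t, j) \<in> ossp_verts M T J" "(m', t', j') \<in> ossp_verts M T J"
  shows "{(m, t, j), (m', t', j')} \<in> ossp_edges M T J \<longleftrightarrow>
    (m, t, j) \<noteq> (m', t', j') \<and> (m = m' \<and> t = t' \<or> j = j')"
proof
  show "{(m, t, j), (m', t', j')} \<in> ossp_edges M T J \<Longrightarrow>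
    (m, t, j) \<noteq> (m', t', j') \<and> (m = m' \<and> t = t' \<or> j = j')"
    by (auto simp: ossp_edges_def doubleton_eq_iff)
  show "(m, t, j) \<noteq> (m', t', j') \<and> (m = m' \<and> t = t' \<or> j = j') \<Longrightarrow>
    {(m, t, j), (m', t', j')} \<in> ossp_edges M T J"
    unfolding ossp_edges_def using assms by blast
qed

section \<open>Solutions and feasibility-preserving permutations\<close>

lemma ossp_no_loop: "{v} \<notin> ossp_edges M T J"
  by (auto simp: ossp_edges_def)

text \<open>Distinct non-adjacent vertices use different jobs and different positions. The other
  \<open>J - 2\<close> jobs then fit injectively into the other \<open>M * T - 2\<close>
  positions.\<close>

lemma ossp_non_adjacent_in_solution:
  assumes le: "J \<le> M * T"
    and u: "u \<in> ossp_verts M T J" and v: "v \<in> ossp_verts M T J"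
    and ne: "u \<noteq> v" and non: "{u, v} \<notin> ossp_edges M T J"
  shows "\<exists>W. ossp_solution M T J W \<and> u \<in> W \<and> v \<in> W"
proof -
  let ?Q = "{1..M} \<times> {1..T}"
  obtain m1 t1 j1 m2 t2 j2 where uv: "u = (m1, t1, j1)" "v = (m2, t2, j2)"
    by (cases u, cases v) auto
  have d: "(m1, t1) \<noteq> (m2, t2)" "j1 \<noteq> j2"
    using non ne u v unfolding uv by (auto simp: ossp_edge_iff)
  have mem: "(m1, t1) \<in> ?Q" "(m2, t2) \<in> ?Q" "j1 \<in> {1..J}" "j2 \<in> {1..J}"
    using u v by (auto simp: uv ossp_verts_def)
  have "card ({1..J} - {j1, j2}) \<le> card (?Q - {(m1, t1), (m2, t2)})"
  proof -
    have "card ({1..J} - {j1, j2}) = J - 2"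
      using mem d by (subst card_Diff_subset) auto
    moreover have "card (?Q - {(m1, t1), (m2, t2)}) = M * T - 2"
      using mem d by (subst card_Diff_subset) (auto simp: card_cartesian_product)
    ultimately show ?thesis using le by (simp only: diff_le_mono)
  qed
  then obtain g where g: "g ` ({1..J} - {j1, j2}) \<subseteq> ?Q - {(m1, t1), (m2, t2)}"
      "inj_on g ({1..J} - {j1, j2})"
    using card_le_inj[of "{1..J} - {j1, j2}" "?Q - {(m1, t1), (m2, t2)}"] by blast
  \<comment> \<open>The schedule: \<open>q\<close> assigns positions to jobs, prescribed by
    \<open>u\<close> and \<open>v\<close> on their two jobs and by the injection \<open>g\<close> on
    the rest.\<close>
  define q where "q j = (if j = j1 then (m1, t1) else if j = j2 then (m2, t2) else g j)" for j
  have gm: "g j \<in> ?Q - {(m1, t1), (m2, t2)}" if "j \<in> {1..J}" "j \<noteq> j1" "j \<noteq> j2" for j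
    using g(1) that by blast
  have q_in: "q j \<in> ?Q" if "j \<in> {1..J}" for j
    using gm[of j] that mem by (auto simp: q_def)
  have q_inj: "j = j'" if jj: "j \<in> {1..J}" "j' \<in> {1..J}" and "q j = q j'" for j j'
    using that(3) gm[OF jj(1)] gm[OF jj(2)] inj_onD[OF g(2), of j j'] jj d
    by (auto simp: q_def split: if_splits)
  define W where "W = (\<lambda>j. (fst (q j), snd (q j), j)) ` {1..J}"
  have WV: "W \<subseteq> ossp_verts M T J"
    using q_in by (auto simp: W_def ossp_verts_def mem_Times_iff)
  have "card W = J" unfolding W_def by (subst card_image) (auto simp: inj_on_def)
  moreover have "independent (ossp_verts M T J) (ossp_edges M T J) W"
    unfolding independent_def
  proof (intro conjI ballI WV)
    fix x y assume xy: "x \<in> W" "y \<in> W"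
    then obtain j j' where j: "j \<in> {1..J}" "x = (fst (q j), snd (q j), j)"
        "j' \<in> {1..J}" "y = (fst (q j'), snd (q j'), j')" unfolding W_def by blast
    have "x \<in> ossp_verts M T J" "y \<in> ossp_verts M T J" using xy WV by blast+
    then have "{x, y} \<in> ossp_edges M T J \<longleftrightarrow> x \<noteq> y \<and> (q j = q j' \<or> j = j')"
      unfolding j by (simp add: ossp_edge_iff prod_eq_iff)
    then show "{x, y} \<notin> ossp_edges M T J" using j q_inj[of j j'] by auto
  qed
  moreover have "u \<in> W" "v \<in> W"
    using mem d by (force simp: W_def uv q_def)+
  ultimately show ?thesis using WV unfolding ossp_solution_def by blast
qed

lemma feas_perms_inv:
  assumes "\<rho> \<in> feas_perms M T J"
  shows "Hilbert_Choice.inv \<rho> \<in> feas_perms M T J"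
proof -
  let ?G = "perm_group (ossp_verts M T J)"
  interpret group ?G by (rule group_perm_group)
  have \<rho>: "\<rho> permutes ossp_verts M T J" using assms by (simp add: feas_perms_def)
  have "inv\<^bsub>?G\<^esub> \<rho> = Hilbert_Choice.inv \<rho>"
    by (rule inv_equality) (use \<rho> permutes_inv[OF \<rho>] in \<open>auto simp: perm_group_def permutes_inv_o\<close>)
  then show ?thesis using subgroup.m_inv_closed[OF subgroup_feas_perms assms] by simp
qed

text \<open>A solution through \<open>u\<close> and \<open>v\<close> is mapped to a solution, which
  is independent and contains both images.\<close>

lemma feas_perm_non_adjacent:
  assumes le: "J \<le> M * T" and \<rho>: "\<rho> \<in> feas_perms M T J"
    and uv: "u \<in> ossp_verts M T J" "v \<in> ossp_verts M T J"
    and non: "{u, v} \<notin> ossp_edges M T J"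
  shows "{\<rho> u, \<rho> v} \<notin> ossp_edges M T J"
proof (cases "u = v")
  case True
  then show ?thesis by (simp add: ossp_no_loop)
next
  case False
  obtain W where "ossp_solution M T J W" "u \<in> W" "v \<in> W"
    using ossp_non_adjacent_in_solution[OF le uv False non] by blast
  then have "ossp_solution M T J (\<rho> ` W)" "\<rho> u \<in> \<rho> ` W" "\<rho> v \<in> \<rho> ` W"
    using \<rho> by (auto simp: feas_perms_def)
  then show ?thesis unfolding ossp_solution_def independent_def by blast
qed

lemma feas_perms_eq_graph_aut:
  assumes le: "J \<le> M * T"
  shows "feas_perms M T J = graph_aut (ossp_verts M T J) (ossp_edges M T J)"
proof (intro equalityI subsetI)
  fix \<rho> assume \<rho>: "\<rho> \<in> feas_perms M T J"
  then have perm: "\<rho> permutes ossp_verts M T J" by (simp add: feas_perms_def)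
  have "{u, v} \<in> ossp_edges M T J \<longleftrightarrow> {\<rho> u, \<rho> v} \<in> ossp_edges M T J"
    if uv: "u \<in> ossp_verts M T J" "v \<in> ossp_verts M T J" for u v
    \<comment> \<open>Non-adjacency is preserved by \<open>\<rho>\<close> and, applying the same
      fact to its inverse, also reflected.\<close>
    using feas_perm_non_adjacent[OF le \<rho> uv]
      feas_perm_non_adjacent[OF le feas_perms_inv[OF \<rho>], of "\<rho> u" "\<rho> v"] uv
    by (auto simp: permutes_in_image[OF perm] permutes_inverses(2)[OF perm])
  with perm show "\<rho> \<in> graph_aut (ossp_verts M T J) (ossp_edges M T J)"
    by (simp add: graph_aut_def)
next
  fix \<rho> assume \<rho>: "\<rho> \<in> graph_aut (ossp_verts M T J) (ossp_edges M T J)"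
  then have perm: "\<rho> permutes ossp_verts M T J" by (simp add: graph_aut_def)
  have "ossp_solution M T J (\<rho> ` W)" if W: "ossp_solution M T J W" for W
  proof -
    have WV: "W \<subseteq> ossp_verts M T J" using W by (simp add: ossp_solution_def)
    then have sub: "\<rho> ` W \<subseteq> ossp_verts M T J"
      by (auto simp: subset_iff permutes_in_image[OF perm])
    have "card (\<rho> ` W) = card W"
      by (rule card_image) (metis inj_on_subset permutes_inj perm subset_UNIV)
    moreover have "{\<rho> u, \<rho> v} \<notin> ossp_edges M T J" if "u \<in> W" "v \<in> W" for u v
    proof -
      have "{u, v} \<notin> ossp_edges M T J"
        using W that by (auto simp: ossp_solution_def independent_def)
      moreover have "u \<in> ossp_verts M T J" "v \<in> ossp_verts M T J" using that WV by blast+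
      ultimately show ?thesis using \<rho> by (simp add: graph_aut_def)
    qed
    ultimately show ?thesis using W sub by (auto simp: ossp_solution_def independent_def)
  qed
  with perm show "\<rho> \<in> feas_perms M T J" by (simp add: feas_perms_def)
qed

section \<open>Reduction to rook graphs\<close>

lemma ossp_rook_coordinates:
  "\<exists>h. bij_betw h (ossp_verts M T J) ({1..M * T} \<times> {1..J}) \<and>
    (\<forall>\<rho>. \<rho> \<in> graph_aut (ossp_verts M T J) (ossp_edges M T J) \<longleftrightarrow>
      \<rho> permutes ossp_verts M T J \<and>
      (\<forall>u\<in>ossp_verts M T J. \<forall>v\<in>ossp_verts M T J.
        collinear (h (\<rho> u)) (h (\<rho> v)) \<longleftrightarrow> collinear (h u) (h v)))"
proof -
  let ?V = "ossp_verts M T J" and ?E = "ossp_edges M T J"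
  have "card ({1..M} \<times> {1..T}) = card {1..M * T}" by (simp add: card_cartesian_product)
  then obtain e where e: "bij_betw e ({1..M} \<times> {1..T}) {1..M * T}"
    by (metis finite_same_card_bij finite_atLeastAtMost finite_cartesian_product)
  define h where "h = (\<lambda>(m, t, j :: nat). (e (m, t), j))"
  have h: "bij_betw h ?V ({1..M * T} \<times> {1..J})"
  proof (rule bij_betwI')
    fix u v assume "u \<in> ?V" "v \<in> ?V"
    then show "h u = h v \<longleftrightarrow> u = v"
      using bij_betw_imp_inj_on[OF e] by (auto simp: h_def ossp_verts_def dest!: inj_onD)
  next
    fix u assume "u \<in> ?V"
    then show "h u \<in> {1..M * T} \<times> {1..J}"
      using bij_betwE[OF e] by (auto simp: h_def ossp_verts_def)
  next
    fix y assume "y \<in> {1..M * T} \<times> {1..J}"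
    then obtain p j where y: "y = (p, j)" "p \<in> e ` ({1..M} \<times> {1..T})" "j \<in> {1..J}"
      using bij_betw_imp_surj_on[OF e] by auto
    then obtain m t where "m \<in> {1..M}" "t \<in> {1..T}" "p = e (m, t)" by auto
    then show "\<exists>u\<in>?V. y = h u"
      using y by (intro bexI[of _ "(m, t, j)"]) (auto simp: h_def ossp_verts_def)
  qed
  have edge: "{u, v} \<in> ?E \<longleftrightarrow> u \<noteq> v \<and> collinear (h u) (h v)" if uv: "u \<in> ?V" "v \<in> ?V" for u v
  proof -
    obtain m t j m' t' j' where eq: "u = (m, t, j)" "v = (m', t', j')"
      by (cases u, cases v) auto
    have "e (m, t) = e (m', t') \<longleftrightarrow> m = m' \<and> t = t'"
      using inj_on_eq_iff[OF bij_betw_imp_inj_on[OF e], of "(m, t)" "(m', t')"] uv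
      by (auto simp: eq ossp_verts_def)
    then show ?thesis using uv unfolding eq by (simp add: ossp_edge_iff h_def collinear_def)
  qed
  \<comment> \<open>For \<open>u = v\<close> both inner equivalences hold, there being no loops
    while collinearity is reflexive; for \<open>u \<noteq> v\<close> edges and collinearity
    coincide.\<close>
  have "({u, v} \<in> ?E \<longleftrightarrow> {\<rho> u, \<rho> v} \<in> ?E) \<longleftrightarrow>
      (collinear (h (\<rho> u)) (h (\<rho> v)) \<longleftrightarrow> collinear (h u) (h v))"
    if \<rho>: "\<rho> permutes ?V" and uv: "u \<in> ?V" "v \<in> ?V" for \<rho> u v
  proof (cases "u = v")
    case True
    then show ?thesis by (simp add: ossp_no_loop collinear_def)
  next
    case False
    then have "\<rho> u \<noteq> \<rho> v" using permutes_inj[OF \<rho>] by (simp add: inj_eq)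
    then show ?thesis using False uv by (auto simp: edge permutes_in_image[OF \<rho>])
  qed
  then have "\<rho> \<in> graph_aut ?V ?E \<longleftrightarrow> \<rho> permutes ?V \<and>
      (\<forall>u\<in>?V. \<forall>v\<in>?V. collinear (h (\<rho> u)) (h (\<rho> v)) \<longleftrightarrow> collinear (h u) (h v))" for \<rho>
    unfolding graph_aut_def by blast
  then show ?thesis using h by blast
qed

text \<open>The common frame for both group structures: \<open>act_col\<close> makes every element
  of \<open>K\<close> act by automorphisms, and \<open>complete\<close> says that no others
  exist.\<close>

lemma aut_iso_of_rook_action:
  fixes K (structure) and h :: "'v \<Rightarrow> 'a \<times> 'b"
  assumes K: "group K"
    and h: "bij_betw h V W"
    and A: "\<And>\<rho>. \<rho> \<in> A \<longleftrightarrow> \<rho> permutes V \<and>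
        (\<forall>u\<in>V. \<forall>v\<in>V. collinear (h (\<rho> u)) (h (\<rho> v)) \<longleftrightarrow> collinear (h u) (h v))"
    and act_bij: "\<And>k. k \<in> carrier K \<Longrightarrow> bij_betw (act k) W W"
    and act_mult: "\<And>k k' w. k \<in> carrier K \<Longrightarrow> k' \<in> carrier K \<Longrightarrow> w \<in> W
        \<Longrightarrow> act (k \<otimes> k') w = act k (act k' w)"
    and faithful: "\<And>k k'. k \<in> carrier K \<Longrightarrow> k' \<in> carrier K
        \<Longrightarrow> (\<And>w. w \<in> W \<Longrightarrow> act k w = act k' w) \<Longrightarrow> k = k'"
    and act_col: "\<And>k u v. k \<in> carrier K \<Longrightarrow> u \<in> W \<Longrightarrow> v \<in> W
        \<Longrightarrow> collinear (act k u) (act k v) \<longleftrightarrow> collinear u v"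
    and complete: "\<And>f. bij_betw f W W
        \<Longrightarrow> (\<And>u v. u \<in> W \<Longrightarrow> v \<in> W \<Longrightarrow> collinear (f u) (f v) \<longleftrightarrow> collinear u v)
        \<Longrightarrow> \<exists>k\<in>carrier K. \<forall>w\<in>W. f w = act k w"
  shows "(perm_group V)\<lparr>carrier := A\<rparr> \<cong> K"
proof (rule perm_group_iso_of_faithful_action[where act = act, OF K h act_bij act_mult faithful])
  have hW: "h v \<in> W" if "v \<in> V" for v using h that by (rule bij_betw_apply)
  have hinv: "inv_into V h w \<in> V" "h (inv_into V h w) = w" if "w \<in> W" for w
    using h that by (metis bij_betw_apply bij_betw_inv_into, metis bij_betw_inv_into_right)
  fix \<rho>
  show "\<rho> \<in> A \<longleftrightarrow> \<rho> permutes V \<and> (\<exists>k\<in>carrier K. \<forall>v\<in>V. h (\<rho> v) = act k (h v))"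
  proof
    assume "\<rho> \<in> A"
    then have \<rho>: "\<rho> permutes V"
      and col: "\<And>u v. u \<in> V \<Longrightarrow> v \<in> V \<Longrightarrow> collinear (h (\<rho> u)) (h (\<rho> v)) \<longleftrightarrow> collinear (h u) (h v)"
      using A by auto
    \<comment> \<open>Conjugation by \<open>h\<close> carries \<open>\<rho>\<close> to a
      collinearity-preserving bijection of \<open>W\<close>, the kind of map that
      \<open>complete\<close> classifies.\<close>
    have "\<exists>k\<in>carrier K. \<forall>w\<in>W. (h \<circ> \<rho> \<circ> inv_into V h) w = act k w"
      by (rule complete[OF bij_betw_conjugate[OF h \<rho>]]) (simp add: col hinv)
    then obtain k where k: "k \<in> carrier K" "\<forall>w\<in>W. (h \<circ> \<rho> \<circ> inv_into V h) w = act k w"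
      by blast
    have "h (\<rho> v) = act k (h v)" if "v \<in> V" for v
      using k(2) hW[OF that] bij_betw_inv_into_left[OF h that] by force
    then show "\<rho> permutes V \<and> (\<exists>k\<in>carrier K. \<forall>v\<in>V. h (\<rho> v) = act k (h v))"
      using \<rho> k(1) by blast
  next
    assume "\<rho> permutes V \<and> (\<exists>k\<in>carrier K. \<forall>v\<in>V. h (\<rho> v) = act k (h v))"
    then obtain k where k: "\<rho> permutes V" "k \<in> carrier K" "\<And>v. v \<in> V \<Longrightarrow> h (\<rho> v) = act k (h v)"
      by blast
    have "collinear (h (\<rho> u)) (h (\<rho> v)) \<longleftrightarrow> collinear (h u) (h v)" if "u \<in> V" "v \<in> V" for u v
      using act_col[OF k(2) hW[OF that(1)] hW[OF that(2)]] that by (simp add: k(3))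
    then show "\<rho> \<in> A" using A k(1) by blast
  qed
qed

section \<open>The two automorphism groups\<close>

lemma product_group_faithful:
  assumes "p permutes A" "p' permutes A" "q permutes B" "q' permutes B" "A \<noteq> {}" "B \<noteq> {}"
    and eq: "\<And>w. w \<in> A \<times> B \<Longrightarrow> map_prod p q w = map_prod p' q' w"
  shows "p = p' \<and> q = q'"
proof
  \<comment> \<open>A fixed point in one factor lets the other coordinate vary freely.\<close>
  obtain a b where "a \<in> A" "b \<in> B" using assms by blast
  then have "p x = p' x" if "x \<in> A" for x using eq[of "(x, b)"] that by simp
  then show "p = p'" using assms permutes_eqI by blast
  have "q x = q' x" if "x \<in> B" for x using eq[of "(a, x)"] that \<open>a \<in> A\<close> by simp
  then show "q = q'" using assms permutes_eqI by blast
qed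

lemma collinear_map_prod:
  assumes "inj p" "inj q"
  shows "collinear (map_prod p q u) (map_prod p q v) \<longleftrightarrow> collinear u v"
  using assms by (cases u, cases v) (simp add: collinear_def inj_eq)

lemma aut_iso_direct_product:
  assumes J: "J \<ge> 1" and less: "J < M * T"
  shows "(perm_group (ossp_verts M T J))\<lparr>carrier := graph_aut (ossp_verts M T J) (ossp_edges M T J)\<rparr>
    \<cong> sym_group (M * T) \<times>\<times> sym_group J"
proof -
  obtain h where h: "bij_betw h (ossp_verts M T J) ({1..M * T} \<times> {1..J})"
    "\<And>\<rho>. \<rho> \<in> graph_aut (ossp_verts M T J) (ossp_edges M T J) \<longleftrightarrow>
      \<rho> permutes ossp_verts M T J \<and>
      (\<forall>u\<in>ossp_verts M T J. \<forall>v\<in>ossp_verts M T J.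
        collinear (h (\<rho> u)) (h (\<rho> v)) \<longleftrightarrow> collinear (h u) (h v))"
    using ossp_rook_coordinates[of M T J] by metis
  define P where "P = M * T"
  define act :: "(nat \<Rightarrow> nat) \<times> (nat \<Rightarrow> nat) \<Rightarrow> nat \<times> nat \<Rightarrow> nat \<times> nat"
    where "act = (\<lambda>(p, q). map_prod p q)"
  let ?K = "sym_group P \<times>\<times> sym_group J" and ?W = "{1..P} \<times> {1..J}"
  have K: "k \<in> carrier ?K \<longleftrightarrow> fst k permutes {1..P} \<and> snd k permutes {1..J}" for k
    by (simp add: DirProd_def sym_group_def mem_Times_iff)
  have P: "2 \<le> P" "J < P" using J less by (simp_all add: P_def)
  show ?thesis
    unfolding P_def[symmetric]
  proof (rule aut_iso_of_rook_action[where act = act, OF _ h[folded P_def]])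
    show "group ?K" by (simp add: DirProd_group sym_group_is_group)
  next
    fix k assume "k \<in> carrier ?K"
    then show "bij_betw (act k) ?W ?W"
      unfolding K act_def split_beta by (blast intro: bij_betw_map_prod permutes_imp_bij)
  next
    fix k k' w
    show "act (k \<otimes>\<^bsub>?K\<^esub> k') w = act k (act k' w)"
      by (simp add: act_def DirProd_def sym_group_def split_beta map_prod_def)
  next
    fix k k'
    assume "k \<in> carrier ?K" "k' \<in> carrier ?K" "\<And>w. w \<in> ?W \<Longrightarrow> act k w = act k' w"
    then have "fst k = fst k' \<and> snd k = snd k'"
      unfolding K act_def split_beta
      by (intro product_group_faithful[of _ "{1..P}" _ _ "{1..J}"]) (use J P in auto)
    then show "k = k'" by (simp add: prod_eq_iff)
  next
    fix k u v assume "k \<in> carrier ?K"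
    then have "inj (fst k)" "inj (snd k)" unfolding K by (blast intro: permutes_inj)+
    then show "collinear (act k u) (act k v) \<longleftrightarrow> collinear u v"
      by (simp add: act_def split_beta collinear_map_prod)
  next
    fix f assume f: "bij_betw f ?W ?W"
      "\<And>u v. u \<in> ?W \<Longrightarrow> v \<in> ?W \<Longrightarrow> collinear (f u) (f v) \<longleftrightarrow> collinear u v"
    show "\<exists>k\<in>carrier ?K. \<forall>w\<in>?W. f w = act k w"
    \<comment> \<open>The transposed case would give \<open>P = J\<close> and is discarded by the
      closing \<open>auto\<close>.\<close>
    proof (rule rook_automorphism_cases[OF f, of 1 2 1])
      fix \<tau> \<sigma>
      assume *: "bij_betw \<tau> {1..P} {1..P}" "bij_betw \<sigma> {1..J} {1..J}"
        "\<And>a b. a \<in> {1..P} \<Longrightarrow> b \<in> {1..J} \<Longrightarrow> f (a, b) = (\<tau> a, \<sigma> b)"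
      obtain p where p: "p permutes {1..P}" "\<And>x. x \<in> {1..P} \<Longrightarrow> p x = \<tau> x"
        using bij_betw_extends_to_permutation[OF *(1)] by blast
      obtain q where q: "q permutes {1..J}" "\<And>x. x \<in> {1..J} \<Longrightarrow> q x = \<sigma> x"
        using bij_betw_extends_to_permutation[OF *(2)] by blast
      have "(p, q) \<in> carrier ?K" unfolding K using p(1) q(1) by simp
      moreover have "\<forall>w\<in>?W. f w = act (p, q) w" using *(3) p(2) q(2) by (auto simp: act_def)
      ultimately show ?thesis by blast
    qed (use J P in auto)
  qed
qed

text \<open>On a square grid the transposition is a further automorphism, and conjugation by it
  exchanges row and column permutations. With \<open>J \<ge> 2\<close> it is not itself a product of
  two permutations, so the action is faithful.\<close>

lemma aut_iso_wreath:
  assumes J: "J \<ge> 2" and eq: "M * T = J"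
  shows "(perm_group (ossp_verts M T J))\<lparr>carrier := graph_aut (ossp_verts M T J) (ossp_edges M T J)\<rparr>
    \<cong> wreath_S2 J"
proof -
  obtain h where h: "bij_betw h (ossp_verts M T J) ({1..M * T} \<times> {1..J})"
    "\<And>\<rho>. \<rho> \<in> graph_aut (ossp_verts M T J) (ossp_edges M T J) \<longleftrightarrow>
      \<rho> permutes ossp_verts M T J \<and>
      (\<forall>u\<in>ossp_verts M T J. \<forall>v\<in>ossp_verts M T J.
        collinear (h (\<rho> u)) (h (\<rho> v)) \<longleftrightarrow> collinear (h u) (h v))"
    using ossp_rook_coordinates[of M T J] by metis
  define act :: "((nat \<Rightarrow> nat) \<times> (nat \<Rightarrow> nat)) \<times> (nat \<Rightarrow> nat) \<Rightarrow> nat \<times> nat \<Rightarrow> nat \<times> nat"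
    \<comment> \<open>The swap comes first: moving it past \<open>map_prod p q\<close> yields
      \<open>map_prod q p\<close>, which is the twist in the semidirect multiplication.\<close>
    where "act = (\<lambda>((p, q), s). map_prod p q \<circ> interchange s)"
  let ?K = "wreath_S2 J" and ?W = "{1..J} \<times> {1..J}"
  define t :: "nat \<Rightarrow> nat" where "t = transpose 1 2"
  \<comment> \<open>As \<open>interchange\<close> only tests for \<open>id\<close>, it respects
    products only once \<open>s\<close> is limited to \<open>id\<close> and the involution
    \<open>t\<close>.\<close>
  have two: "s permutes {1..2} \<longleftrightarrow> s = id \<or> s = t" for s :: "nat \<Rightarrow> nat"
    unfolding t_def
    using permutes_1_2[of s] permutes_id permutes_swap_id[of 1 "{1..2::nat}" 2] by fastforce
  have t_ne: "t \<noteq> id"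
    unfolding t_def by (metis id_apply n_not_Suc_n numeral_2_eq_2 One_nat_def transpose_apply_first)
  have t_t: "t \<circ> t = id" by (simp add: t_def)
  have K: "k \<in> carrier ?K \<longleftrightarrow>
      fst (fst k) permutes {1..J} \<and> snd (fst k) permutes {1..J} \<and> (snd k = id \<or> snd k = t)" for k
    by (simp only: wreath_S2_def semidirect_def DirProd_def sym_group_def two mem_Times_iff
        partial_object.simps mem_Collect_eq) blast
  show ?thesis
  proof (rule aut_iso_of_rook_action[where act = act, OF group_wreath_S2 h[unfolded eq]])
    fix k assume k: "k \<in> carrier ?K"
    have "bij_betw prod.swap ?W ?W" by (auto simp: bij_betw_def product_swap)
    then have "bij_betw (interchange (snd k)) ?W ?W" by (simp add: interchange_def)
    moreover have "bij_betw (map_prod (fst (fst k)) (snd (fst k))) ?W ?W"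
      using k by (intro bij_betw_map_prod permutes_imp_bij) (auto simp: K)
    ultimately show "bij_betw (act k) ?W ?W"
      by (auto simp: act_def split_beta intro: bij_betw_trans)
  next
    fix k k' w assume "k \<in> carrier ?K" "k' \<in> carrier ?K"
    then have "snd k = id \<or> snd k = t" "snd k' = id \<or> snd k' = t" unfolding K by blast+
    then show "act (k \<otimes>\<^bsub>?K\<^esub> k') w = act k (act k' w)"
      by (elim disjE; cases w)
        (simp_all add: act_def wreath_S2_def semidirect_def DirProd_def sym_group_def split_beta
          interchange_def t_ne t_t)
  next
    fix k k'
    assume k: "k \<in> carrier ?K" "k' \<in> carrier ?K" and same: "\<And>w. w \<in> ?W \<Longrightarrow> act k w = act k' w"
    obtain p q s p' q' s' where kk: "k = ((p, q), s)" "k' = ((p', q'), s')"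
      by (cases k, cases k') auto
    have pq: "p permutes {1..J}" "q permutes {1..J}" "s = id \<or> s = t"
        "p' permutes {1..J}" "q' permutes {1..J}" "s' = id \<or> s' = t"
      using k by (simp_all only: K kk fst_conv snd_conv)
    have inj: "inj p" "inj q" "inj p'" "inj q'" using pq permutes_inj by auto
    have mem: "(1, 1) \<in> ?W" "(1, 2) \<in> ?W" using J by auto
    txt \<open>The images of \<open>(1, 1)\<close> and \<open>(1, 2)\<close> agree in the first coordinate precisely if \<open>s = id\<close>.\<close>
    have "s = s'"
      using same[OF mem(1)] same[OF mem(2)] pq(3,6) inj
      by (auto simp: kk act_def interchange_def t_ne inj_eq)
    have "map_prod p q w = map_prod p' q' w" if "w \<in> ?W" for w
    proof (cases "s = id")
      case True
      then show ?thesis using same[OF that] \<open>s = s'\<close> by (simp add: kk act_def interchange_def)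
    next
      case False
      \<comment> \<open>Here both actions begin with a swap, so agreement is used at the swapped
        point to recover \<open>w\<close>.\<close>
      have "prod.swap w \<in> ?W" using that by auto
      from same[OF this] show ?thesis
        using False \<open>s = s'\<close> by (simp add: kk act_def interchange_def)
    qed
    then show "k = k'"
      using product_group_faithful[OF pq(1,4,2,5)] J \<open>s = s'\<close> by (auto simp: kk)
  next
    fix k and u v :: "nat \<times> nat" assume "k \<in> carrier ?K"
    then have inj: "inj (fst (fst k))" "inj (snd (fst k))"
      unfolding K by (blast intro: permutes_inj)+
    have "collinear (interchange (snd k) u) (interchange (snd k) v) \<longleftrightarrow> collinear u v"
      by (auto simp: interchange_def collinear_def)
    with inj show "collinear (act k u) (act k v) \<longleftrightarrow> collinear u v"
      by (simp add: act_def split_beta collinear_map_prod)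
  next
    fix f assume f: "bij_betw f ?W ?W"
      "\<And>u v. u \<in> ?W \<Longrightarrow> v \<in> ?W \<Longrightarrow> collinear (f u) (f v) \<longleftrightarrow> collinear u v"
    have wit: "\<exists>k\<in>carrier ?K. \<forall>w\<in>?W. f w = act k w"
      if b: "bij_betw \<tau> {1..J} {1..J}" "bij_betw \<sigma> {1..J} {1..J}"
        and s: "s = id \<or> s = t"
        and f: "\<And>w. w \<in> ?W \<Longrightarrow> f w = map_prod \<tau> \<sigma> (interchange s w)" for \<tau> \<sigma> s
    proof -
      obtain p where p: "p permutes {1..J}" "\<And>x. x \<in> {1..J} \<Longrightarrow> p x = \<tau> x"
        using bij_betw_extends_to_permutation[OF b(1)] by blast
      obtain q where q: "q permutes {1..J}" "\<And>x. x \<in> {1..J} \<Longrightarrow> q x = \<sigma> x"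
        using bij_betw_extends_to_permutation[OF b(2)] by blast
      show ?thesis
       by (rule bexI[of _ "((p, q), s)"])
          (use s f p q in \<open>auto simp: K act_def interchange_def\<close>)
    qed
    show "\<exists>k\<in>carrier ?K. \<forall>w\<in>?W. f w = act k w"
    proof (rule rook_automorphism_cases[OF f, of 1 2 1])
      fix \<tau> \<sigma>
      assume *: "bij_betw \<tau> {1..J} {1..J}" "bij_betw \<sigma> {1..J} {1..J}"
        "\<And>a b. a \<in> {1..J} \<Longrightarrow> b \<in> {1..J} \<Longrightarrow> f (a, b) = (\<tau> a, \<sigma> b)"
      show ?thesis
       by (rule wit[OF *(1,2), of id]) (use * in \<open>auto simp: interchange_def\<close>)
    next
      fix \<tau> \<sigma>
      assume *: "bij_betw \<tau> {1..J} {1..J}" "bij_betw \<sigma> {1..J} {1..J}"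
        "\<And>a b. a \<in> {1..J} \<Longrightarrow> b \<in> {1..J} \<Longrightarrow> f (a, b) = (\<tau> b, \<sigma> a)"
      show ?thesis
       \<comment> \<open>The value \<open>(\<tau> b, \<sigma> a)\<close> is
         \<open>map_prod \<tau> \<sigma>\<close> at the swapped point, hence the component
         \<open>t\<close>.\<close>
       by (rule wit[OF *(1,2), of t]) (use * t_ne in \<open>auto simp: interchange_def\<close>)
    qed (use J in auto)
  qed
qed

theorem mainTheorem1:
  fixes M T J :: nat
  assumes "M \<ge> 1" and "T \<ge> 1" and "J \<ge> 1"
    and "M * T \<ge> J"
  defines "V \<equiv> ossp_verts M T J"
    and "E \<equiv> ossp_edges M T J"
  shows "feas_perms M T J = graph_aut V E
    \<and> (M * T = J \<and> J \<noteq> 1 \<longrightarrow>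
         (perm_group V)\<lparr>carrier := graph_aut V E\<rparr> \<cong> wreath_S2 J)
    \<and> (M * T > J \<longrightarrow>
         (perm_group V)\<lparr>carrier := graph_aut V E\<rparr> \<cong> sym_group (M * T) \<times>\<times> sym_group J)"
proof (intro conjI impI)
  show "feas_perms M T J = graph_aut V E"
    unfolding V_def E_def by (rule feas_perms_eq_graph_aut) (use assms in simp)
next
  assume "M * T = J \<and> J \<noteq> 1"
  \<comment> \<open>Together with \<open>J \<ge> 1\<close>, excluding \<open>J = 1\<close> leaves
    \<open>J \<ge> 2\<close>, where the transposition acts non-trivially.\<close>
  then show "(perm_group V)\<lparr>carrier := graph_aut V E\<rparr> \<cong> wreath_S2 J"
    unfolding V_def E_def by (intro aut_iso_wreath) (use assms(3) in linarith, blast)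
next
  assume "M * T > J"
  then show "(perm_group V)\<lparr>carrier := graph_aut V E\<rparr> \<cong> sym_group (M * T) \<times>\<times> sym_group J"
    unfolding V_def E_def by (intro aut_iso_direct_product) (use assms(3) in auto)
qed

end
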